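(* For any tree $T$ of order at least $3$, $b_{\rm R}(T)\le\Delta(T)$.
   Context: Graphs are finite, undirected, without loops or multiple edges; a graph is nonempty if it has at least one edge; $\Delta(T)$ is the maximum degree. A Roman dominating function on $G=(V,E)$ is a function $f:V\to\{0,1,2\}$ such that every vertex $x$ with $f(x)=0$ is adjacent to at least one vertex $y$ with $f(y)=2$. Its weight is $\sum_{u\in V}f(u)$. The Roman domination number $\gamma_{\rm R}(G)$ is the minimum weight of a Roman dominating function on $G$. The Roman bondage number of a nonempty graph $G$ is $b_{\rm R}(G)=\min\{|B|: B\subseteq E(G),\ \gamma_{\rm R}(G-B)>\gamma_{\rm R}(G)\}$, with $b_{\rm R}(G)=\infty$ if no such $B$ exists; here $G-B$ is obtained from $G$ by deleting the edges in $B$ (keeping all vertices). *)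

theory Defs
  imports "Graph_Theory.Graph_Theory" "HOL-Library.Extended_Nat"
begin

text \<open>
  A finite simple undirected graph is a \<open>pair_graph\<close>: a finite, symmetric, loop-free set of ordered
  pairs, in which both orientations \<open>(u, v)\<close> and \<open>(v, u)\<close> stand for the single undirected edge
  \<open>{u, v}\<close>.  Edge sets and their cardinalities are therefore taken over unordered pairs.
\<close>

definition edges :: "'a pair_pre_digraph \<Rightarrow> 'a set set" where
  "edges G = {{u, v} | u v. (u, v) \<in> parcs G}"

definition delete_edges :: "'a pair_pre_digraph \<Rightarrow> 'a set set \<Rightarrow> 'a pair_pre_digraph" where
  "delete_edges G B = \<lparr>pverts = pverts G, parcs = {(u, v). (u, v) \<in> parcs G \<and> {u, v} \<notin> B}\<rparr>"

lemma pair_graph_delete_edges: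
  assumes "pair_graph G"
  shows "pair_graph (delete_edges G B)"
proof -
  interpret pair_graph G by fact
  have "finite (parcs (delete_edges G B))"
    by (rule finite_subset[of _ "parcs G"]) (auto simp: delete_edges_def)
  moreover have "(v, u) \<in> parcs G" if "(u, v) \<in> parcs G" for u v
    using that by (rule arcs_symmetric)
  ultimately show ?thesis
    by unfold_locales
      (auto simp: delete_edges_def symmetric_def insert_commute no_loops' intro!: symI
        dest: in_arcsD1 in_arcsD2)
qed

lemma edges_delete_edges: "edges (delete_edges G B) = edges G - B"
  by (auto simp: edges_def delete_edges_def)

text \<open>
  The library's predicate \<open>tree\<close> is meant for directed graphs: its \<open>forest\<close> counts the closed walk
  \<open>u, v, u\<close> along the two orientations of one edge as a cycle.  Cycles of an undirected graph are the
  library's cycles of length at least three.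
\<close>

definition undirected_tree :: "'a pair_pre_digraph \<Rightarrow> bool" where
  "undirected_tree G \<longleftrightarrow>
     pair_graph G \<and> Digraph_Component.connected G \<and>
     \<not> (\<exists>p. pre_digraph.cycle G p \<and> 3 \<le> length p)"

text \<open>In a symmetric digraph the out-degree of a vertex is its degree in the undirected graph.\<close>

definition max_degree :: "'a pair_pre_digraph \<Rightarrow> nat" where
  "max_degree G = Max (out_degree G ` pverts G)"

definition roman_dominating :: "'a pair_pre_digraph \<Rightarrow> ('a \<Rightarrow> nat) \<Rightarrow> bool" where
  "roman_dominating G f \<longleftrightarrow>
     (\<forall>x\<in>pverts G. f x \<in> {0, 1, 2}) \<and>
     (\<forall>x\<in>pverts G. f x = 0 \<longrightarrow> (\<exists>y\<in>pverts G. (x, y) \<in> parcs G \<and> f y = 2))"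

definition weight :: "'a pair_pre_digraph \<Rightarrow> ('a \<Rightarrow> nat) \<Rightarrow> nat" where
  "weight G f = (\<Sum>u\<in>pverts G. f u)"

definition roman_domination_number :: "'a pair_pre_digraph \<Rightarrow> nat" where
  "roman_domination_number G = Inf {weight G f | f. roman_dominating G f}"

text \<open>The infimum is a minimum, since the constant function 1 is always Roman dominating.\<close>

lemma roman_domination_number_attained:
  "\<exists>f. roman_dominating G f \<and> weight G f = roman_domination_number G"
proof -
  have "roman_dominating G (\<lambda>_. 1)"
    by (simp add: roman_dominating_def)
  then have "{weight G f | f. roman_dominating G f} \<noteq> {}"
    by blast
  from Inf_nat_def1[OF this] show ?thesis
    by (auto simp: roman_domination_number_def)
qed

text \<open>The infimum of the empty set in \<^typ>\<open>enat\<close> is \<open>\<infinity>\<close>.\<close>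

definition roman_bondage_number :: "'a pair_pre_digraph \<Rightarrow> enat" where
  "roman_bondage_number G =
     Inf {enat (card B) | B. B \<subseteq> edges G \<and>
       roman_domination_number (delete_edges G B) > roman_domination_number G}"

end

theory Submission
  imports Defs
begin

text \<open>
  A set \<open>B\<close> of edges raises the Roman domination number as soon as it splits off a small vertex set
  \<open>S\<close> on which every Roman dominating function of \<open>G - B\<close> is more expensive than some Roman dominating
  function of the subgraph of \<open>G\<close> induced on \<open>S\<close>: replacing the values on \<open>S\<close> of an optimal function
  of \<open>G - B\<close> by the cheaper ones gives a function of \<open>G\<close>
  (\<open>roman_domination_number_less_if_block\<close>).  So it suffices to find such an \<open>S\<close> near the end of the
  tree that can be split off by at most \<open>\<Delta>(T)\<close> edges.

  Say that a vertex \<open>c\<close> carries a leg \<open>x - y - c\<close> if \<open>x\<close> is a leaf and \<open>x\<close>, \<open>c\<close> are the only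
  neighbours of \<open>y\<close>.  In four configurations the required \<open>S\<close> exists:
  \<^item> two leaves \<open>a\<close>, \<open>b\<close> at a common vertex \<open>v\<close>: isolating \<open>v\<close> leaves three isolated vertices, of
    cost 3, whereas 2 at \<open>v\<close> suffices for \<open>S = {v, a, b}\<close> in \<open>T\<close>;
  \<^item> a leg and a leaf at \<open>c\<close>: isolating \<open>c\<close> gives cost \<open>1 + 2 + 1\<close> instead of 3;
  \<^item> two legs at \<open>c\<close>: isolating \<open>c\<close> gives cost \<open>1 + 2 + 2\<close> instead of 4;
  \<^item> a leg \<open>x - y - z\<close> where \<open>z\<close> has just one further neighbour \<open>t\<close>: deleting the two edges
    \<open>xy\<close> and \<open>zt\<close> gives cost \<open>1 + 2\<close> instead of 2 on \<open>{x, y, z}\<close>, and \<open>2 \<le> \<Delta>(T)\<close> because of \<open>y\<close>.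

  One of them always occurs.  If there are no twin leaves, a longest path \<open>x, y, z, t, \<dots>\<close> has at
  least four vertices.  Maximality and acyclicity force every neighbour of \<open>y\<close> other than \<open>z\<close> to be a
  leaf, and \<open>x\<close> is the only one, so \<open>x - y - z\<close> is a leg; likewise every neighbour of \<open>z\<close> other than \<open>t\<close>
  is a leaf or the middle of a leg at \<open>z\<close>.  Hence \<open>z\<close> carries, besides this leg, a leaf, a second leg, or nothing
  but \<open>t\<close>.
\<close>

section \<open>Local surgery on Roman dominating functions\<close>

lemma parcs_delete_edges [simp]:
  "(u, v) \<in> parcs (delete_edges G B) \<longleftrightarrow> (u, v) \<in> parcs G \<and> {u, v} \<notin> B"
  by (simp add: delete_edges_def)

lemma pverts_delete_edges [simp]: "pverts (delete_edges G B) = pverts G"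
  by (simp add: delete_edges_def)

lemma roman_domination_number_le:
  "roman_dominating G f \<Longrightarrow> roman_domination_number G \<le> weight G f"
  unfolding roman_domination_number_def by (rule wellorder_Inf_le1) auto

text \<open>
  No edge of \<open>G - B\<close> joins \<open>S\<close> to its complement, so in an optimal function \<open>f\<close> of \<open>G - B\<close> the
  vertices of value 0 outside \<open>S\<close> are defended from outside \<open>S\<close>.  Overwriting \<open>f\<close> by \<open>h\<close> on \<open>S\<close> therefore
  keeps them defended, and \<open>h\<close> defends \<open>S\<close> by itself using the edges of \<open>G\<close>.
\<close>

lemma roman_domination_number_less_if_block:
  assumes G: "pair_graph G" and S: "S \<subseteq> pverts G"
    and block: "\<And>u v. u \<in> S \<Longrightarrow> (u, v) \<in> parcs (delete_edges G B) \<Longrightarrow> v \<in> S"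
    and vals: "\<And>x. x \<in> S \<Longrightarrow> h x \<in> {0, 1, 2}"
    and dom: "\<And>x. x \<in> S \<Longrightarrow> h x = 0 \<Longrightarrow> \<exists>y\<in>S. (x, y) \<in> parcs G \<and> h y = 2"
    and less: "\<And>f. roman_dominating (delete_edges G B) f \<Longrightarrow> sum h S < sum f S"
  shows "roman_domination_number G < roman_domination_number (delete_edges G B)"
proof -
  interpret pair_graph G by fact
  obtain f where f: "roman_dominating (delete_edges G B) f"
    and wf: "weight (delete_edges G B) f = roman_domination_number (delete_edges G B)"
    using roman_domination_number_attained by blast
  define g where "g = (\<lambda>x. if x \<in> S then h x else f x)"
  have "roman_dominating G g"
    unfolding roman_dominating_def
  proof (intro conjI ballI impI)
    fix x assume "x \<in> pverts G"
    then show "g x \<in> {0, 1, 2}"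
      using f vals by (auto simp: g_def roman_dominating_def)
  next
    fix x assume x: "x \<in> pverts G" "g x = 0"
    show "\<exists>y\<in>pverts G. (x, y) \<in> parcs G \<and> g y = 2"
    proof (cases "x \<in> S")
      case True
      then show ?thesis using dom x S by (fastforce simp: g_def)
    next
      case False
      then obtain y where y: "y \<in> pverts G" "(x, y) \<in> parcs (delete_edges G B)" "f y = 2"
        using f x by (auto simp: g_def roman_dominating_def)
      then have "(y, x) \<in> parcs (delete_edges G B)"
        by (auto simp: insert_commute intro: arcs_symmetric)
      then have "y \<notin> S" using block False by blast
      then show ?thesis using y by (auto simp: g_def)
    qed
  qed
  then have "roman_domination_number G \<le> weight G g"
    by (rule roman_domination_number_le)
  also have "weight G g = sum g (pverts G - S) + sum g S"
    unfolding weight_def using S by (rule sum.subset_diff) simp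
  also have "\<dots> = sum f (pverts G - S) + sum h S"
    by (simp add: g_def)
  also have "\<dots> < sum f (pverts G - S) + sum f S"
    using less[OF f] by simp
  also have "\<dots> = weight (delete_edges G B) f"
    unfolding weight_def using sum.subset_diff[OF S, of f] by simp
  finally show ?thesis using wf by simp
qed

lemma roman_dominating_isolated:
  assumes "roman_dominating G f" "x \<in> pverts G" "\<And>y. (x, y) \<notin> parcs G"
  shows "1 \<le> f x"
  using assms by (fastforce simp: roman_dominating_def)

lemma roman_dominating_isolated_edge:
  assumes f: "roman_dominating G f" and xy: "x \<in> pverts G" "y \<in> pverts G"
    and "\<And>z. (x, z) \<in> parcs G \<Longrightarrow> z = y" "\<And>z. (y, z) \<in> parcs G \<Longrightarrow> z = x"
  shows "2 \<le> f x + f y"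
proof -
  have "f x = 0 \<Longrightarrow> f y = 2" "f y = 0 \<Longrightarrow> f x = 2"
    using assms unfolding roman_dominating_def by metis+
  then show ?thesis by linarith
qed

lemma roman_bondage_number_le:
  assumes "B \<subseteq> edges G"
    and "roman_domination_number G < roman_domination_number (delete_edges G B)"
    and "card B \<le> n"
  shows "roman_bondage_number G \<le> enat n"
proof -
  have "roman_bondage_number G \<le> enat (card B)"
    unfolding roman_bondage_number_def using assms by (intro Inf_lower) auto
  then show ?thesis using assms(3) by (meson enat_ord_simps(1) order_trans)
qed

definition incident_edges :: "'a pair_pre_digraph \<Rightarrow> 'a \<Rightarrow> 'a set set" where
  "incident_edges G v = (\<lambda>u. {v, u}) ` {u. (v, u) \<in> parcs G}"

lemma card_neighbours_le_max_degree:
  assumes "pair_graph G" "v \<in> pverts G"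
  shows "card {u. (v, u) \<in> parcs G} \<le> max_degree G"
proof -
  interpret pair_graph G by fact
  have "out_arcs G v = Pair v ` {u. (v, u) \<in> parcs G}"
    by (auto simp: out_arcs_def)
  then have "out_degree G v = card {u. (v, u) \<in> parcs G}"
    by (simp add: out_degree_def card_image inj_on_def)
  then show ?thesis
    using assms(2) by (metis Max_ge finite_imageI imageI max_degree_def pair_finite_verts)
qed

text \<open>
  The choice of \<open>B\<close> that produces the maximum degree in the bound: all edges at one vertex.
\<close>

lemma roman_bondage_number_le_if_isolating:
  assumes "pair_graph G" "v \<in> pverts G"
    and "roman_domination_number G < roman_domination_number (delete_edges G (incident_edges G v))"
  shows "roman_bondage_number G \<le> enat (max_degree G)"
proof (rule roman_bondage_number_le[OF _ assms(3)])
  show "incident_edges G v \<subseteq> edges G"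
    by (auto simp: incident_edges_def edges_def)
  interpret pair_graph G by fact
  have "finite {u. (v, u) \<in> parcs G}"
    by (rule finite_subset[of _ "pverts G"]) (auto dest: in_arcsD2)
  then have "card (incident_edges G v) \<le> card {u. (v, u) \<in> parcs G}"
    unfolding incident_edges_def by (rule card_image_le)
  also have "\<dots> \<le> max_degree G"
    using assms by (intro card_neighbours_le_max_degree)
  finally show "card (incident_edges G v) \<le> max_degree G" .
qed

section \<open>Pendant configurations\<close>

definition leaf_at :: "'a pair_pre_digraph \<Rightarrow> 'a \<Rightarrow> 'a \<Rightarrow> bool" where
  "leaf_at G l v \<longleftrightarrow> (l, v) \<in> parcs G \<and> (\<forall>u. (l, u) \<in> parcs G \<longrightarrow> u = v)"

text \<open>
  A pendant path \<open>x - y - c\<close> of length two; the vertex \<open>c\<close> where it is attached may have any degree.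
\<close>

definition leg_at :: "'a pair_pre_digraph \<Rightarrow> 'a \<Rightarrow> 'a \<Rightarrow> 'a \<Rightarrow> bool" where
  "leg_at G x y c \<longleftrightarrow> leaf_at G x y \<and> (y, c) \<in> parcs G \<and> x \<noteq> c \<and>
     (\<forall>u. (y, u) \<in> parcs G \<longrightarrow> u = x \<or> u = c)"

context pair_graph
begin

lemma parcs_delete_incident_edges:
  "(u, w) \<in> parcs (delete_edges G (incident_edges G v)) \<longleftrightarrow>
    (u, w) \<in> parcs G \<and> u \<noteq> v \<and> w \<noteq> v"
  using arcs_symmetric by (auto simp: incident_edges_def doubleton_eq_iff)

lemma leaf_at_adj:
  assumes "leaf_at G l v"
  shows "(l, v) \<in> parcs G" "l \<in> pverts G" "v \<in> pverts G" "l \<noteq> v"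
  using assms unfolding leaf_at_def by (blast dest: in_arcsD1 in_arcsD2 no_loops')+

lemma leaf_at_unique: "leaf_at G l v \<Longrightarrow> (l, u) \<in> parcs G \<Longrightarrow> u = v"
  by (simp add: leaf_at_def)

lemma leg_at_adj:
  assumes "leg_at G x y c"
  shows "leaf_at G x y" "(y, c) \<in> parcs G" "(c, y) \<in> parcs G" "(x, y) \<in> parcs G" "(y, x) \<in> parcs G"
    "x \<in> pverts G" "y \<in> pverts G" "c \<in> pverts G" "x \<noteq> y" "y \<noteq> c" "x \<noteq> c"
proof -
  show x: "leaf_at G x y" and "x \<noteq> c" and yc: "(y, c) \<in> parcs G"
    using assms by (simp_all add: leg_at_def)
  show "(c, y) \<in> parcs G" "(x, y) \<in> parcs G" "(y, x) \<in> parcs G"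
    using leaf_at_adj[OF x] yc by (simp_all add: arcs_symmetric)
  show "x \<in> pverts G" "y \<in> pverts G" "c \<in> pverts G" "x \<noteq> y" "y \<noteq> c"
    using leaf_at_adj[OF x] yc by (simp_all add: in_arcsD2 no_loops')
qed

lemma leg_at_cases: "leg_at G x y c \<Longrightarrow> (y, u) \<in> parcs G \<Longrightarrow> u = x \<or> u = c"
  by (simp add: leg_at_def)

text \<open>
  Isolating \<open>c\<close> also isolates every leaf at \<open>c\<close>, and it turns a leg at \<open>c\<close> into a component with a
  single edge (\<open>leg_weight\<close>); these two costs add up to the lower bound
  on \<open>S\<close> whenever a vertex is isolated.
\<close>

lemma isolated_weight:
  assumes f: "roman_dominating (delete_edges G (incident_edges G c)) f"
    and u: "u = c \<or> leaf_at G u c" and c: "c \<in> pverts G"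
  shows "1 \<le> f u"
proof (rule roman_dominating_isolated[OF f])
  show "u \<in> pverts (delete_edges G (incident_edges G c))"
    using u c leaf_at_adj by auto
  show "(u, w) \<notin> parcs (delete_edges G (incident_edges G c))" for w
    unfolding parcs_delete_incident_edges using u leaf_at_unique by blast
qed

lemma leg_weight:
  assumes leg: "leg_at G x y c" and f: "roman_dominating (delete_edges G (incident_edges G c)) f"
  shows "2 \<le> f x + f y"
proof (rule roman_dominating_isolated_edge[OF f])
  show "z = y" if "(x, z) \<in> parcs (delete_edges G (incident_edges G c))" for z
    using that leaf_at_unique[OF leg_at_adj(1)[OF leg]]
    unfolding parcs_delete_incident_edges by blast
  show "z = x" if "(y, z) \<in> parcs (delete_edges G (incident_edges G c))" for z
    using that leg_at_cases[OF leg] unfolding parcs_delete_incident_edges by blast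
qed (use leg_at_adj[OF leg] in simp_all)

lemma bondage_twin_leaves:
  assumes a: "leaf_at G a v" and b: "leaf_at G b v" and "a \<noteq> b"
  shows "roman_bondage_number G \<le> enat (max_degree G)"
proof (rule roman_bondage_number_le_if_isolating[OF pair_graph])
  note A = leaf_at_adj[OF a] leaf_at_adj[OF b]
  let ?H = "delete_edges G (incident_edges G v)"
  let ?h = "(\<lambda>_. 0)(v := 2::nat)"
  let ?S = "{v, a, b}"
  show "roman_domination_number G < roman_domination_number ?H"
  proof (rule roman_domination_number_less_if_block[where S = ?S and h = ?h, OF pair_graph])
    fix f assume f: "roman_dominating ?H f"
    have "1 \<le> f v" "1 \<le> f a" "1 \<le> f b"
      using a b A by (blast intro: isolated_weight[OF f])+
    then show "sum ?h ?S < sum f ?S"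
      using A \<open>a \<noteq> b\<close> by simp
  next
    fix u assume "u \<in> ?S" "?h u = 0"
    then have "u = a \<or> u = b" by auto
    then show "\<exists>w\<in>?S. (u, w) \<in> parcs G \<and> ?h w = 2"
      using A by auto
  next
    fix u w assume "u \<in> ?S" "(u, w) \<in> parcs ?H"
    then show "w \<in> ?S"
      using leaf_at_unique[OF a] leaf_at_unique[OF b]
      unfolding parcs_delete_incident_edges by blast
  qed (use A in auto)
  show "v \<in> pverts G" by (fact A)
qed

text \<open>
  With value 2 at \<open>c\<close> the vertices \<open>y\<close> and \<open>l\<close> are free, and only \<open>x\<close> still costs 1.
\<close>

lemma bondage_leg_leaf:
  assumes leg: "leg_at G x y c" and l: "leaf_at G l c" and "l \<noteq> y"
  shows "roman_bondage_number G \<le> enat (max_degree G)"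
proof (rule roman_bondage_number_le_if_isolating[OF pair_graph])
  note A = leg_at_adj[OF leg] leaf_at_adj[OF l]
  let ?H = "delete_edges G (incident_edges G c)"
  let ?h = "(\<lambda>_. 0)(c := 2::nat, x := 1)"
  let ?S = "{c, x, y, l}"
  have d: "l \<noteq> x" using leaf_at_unique[OF l] A by blast
  show "roman_domination_number G < roman_domination_number ?H"
  proof (rule roman_domination_number_less_if_block[where S = ?S and h = ?h, OF pair_graph])
    fix f assume f: "roman_dominating ?H f"
    have "1 \<le> f c" "1 \<le> f l" "2 \<le> f x + f y"
      using l A leg_weight[OF leg f] by (blast intro: isolated_weight[OF f])+
    then show "sum ?h ?S < sum f ?S"
      using A d \<open>l \<noteq> y\<close> by (simp add: eq_commute)
  next
    fix u assume "u \<in> ?S" "?h u = 0"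
    then have "u = y \<or> u = l" by (auto split: if_splits)
    then show "\<exists>w\<in>?S. (u, w) \<in> parcs G \<and> ?h w = 2"
      using A by auto
  next
    fix u w assume "u \<in> ?S" "(u, w) \<in> parcs ?H"
    then show "w \<in> ?S"
      using leaf_at_unique[OF l] leaf_at_unique[OF A(1)] leg_at_cases[OF leg]
      unfolding parcs_delete_incident_edges by blast
  qed (use A in auto)
  show "c \<in> pverts G" by (fact A)
qed

text \<open>
  With value 2 at \<open>c\<close> each leg costs only 1, at its leaf, whereas a leg on its own costs 2.
  The gain of 1 on each of two legs exceeds the extra cost 1 of the value 2 at \<open>c\<close>.
\<close>

lemma bondage_two_legs:
  assumes leg: "leg_at G x y c" and leg': "leg_at G x' y' c" and ne: "y \<noteq> y'"
  shows "roman_bondage_number G \<le> enat (max_degree G)"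
proof (rule roman_bondage_number_le_if_isolating[OF pair_graph])
  note A = leg_at_adj[OF leg] and A' = leg_at_adj[OF leg']
  let ?H = "delete_edges G (incident_edges G c)"
  let ?h = "(\<lambda>_. 0)(c := 2::nat, x := 1, x' := 1)"
  let ?S = "{c, x, y, x', y'}"
  have d: "x \<noteq> x'" "x \<noteq> y'" "x' \<noteq> y"
    using leaf_at_unique[OF A(1)] leaf_at_unique[OF A'(1)] A A' ne by blast+
  show "roman_domination_number G < roman_domination_number ?H"
  proof (rule roman_domination_number_less_if_block[where S = ?S and h = ?h, OF pair_graph])
    fix f assume f: "roman_dominating ?H f"
    have "1 \<le> f c" using A by (blast intro: isolated_weight[OF f])
    moreover have "2 \<le> f x + f y" "2 \<le> f x' + f y'"
      using leg leg' f by (blast intro: leg_weight)+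
    ultimately show "sum ?h ?S < sum f ?S"
      using A A' d ne by (simp add: eq_commute)
  next
    fix u assume "u \<in> ?S" "?h u = 0"
    then have "u = y \<or> u = y'" by (auto split: if_splits)
    then show "\<exists>w\<in>?S. (u, w) \<in> parcs G \<and> ?h w = 2"
      using A A' by auto
  next
    fix u w assume "u \<in> ?S" "(u, w) \<in> parcs ?H"
    then show "w \<in> ?S"
      using leaf_at_unique[OF A(1)] leg_at_cases[OF leg]
        leaf_at_unique[OF A'(1)] leg_at_cases[OF leg']
      unfolding parcs_delete_incident_edges by blast
  qed (use A A' in auto)
  show "c \<in> pverts G" by (fact A)
qed

text \<open>
  Isolating \<open>z\<close> gains nothing on \<open>{x, y, z}\<close> over the values 2 at \<open>z\<close> and 1 at \<open>x\<close>.  The path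
  \<open>x - y - z\<close> is instead cut off from the rest at \<open>zt\<close> and broken at \<open>xy\<close>, so that the value 2 in
  its middle no longer suffices.
\<close>

lemma bondage_pendant_path:
  assumes leg: "leg_at G x y z" and zt: "(z, t) \<in> parcs G"
    and z: "\<And>u. (z, u) \<in> parcs G \<Longrightarrow> u = y \<or> u = t"
  shows "roman_bondage_number G \<le> enat (max_degree G)"
proof (rule roman_bondage_number_le)
  note A = leg_at_adj[OF leg]
  let ?B = "{{x, y}, {z, t}}"
  let ?H = "delete_edges G ?B"
  let ?h = "(\<lambda>_. 0)(y := 2::nat)"
  let ?S = "{x, y, z}"
  have x: "(x, u) \<notin> parcs ?H" for u
    using leaf_at_unique[OF A(1)] by auto
  have y: "u = z" if "(y, u) \<in> parcs ?H" for u
    using leg_at_cases[OF leg, of u] that by (auto simp: insert_commute)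
  have z: "u = y" if "(z, u) \<in> parcs ?H" for u
    using z[of u] that by auto
  show "roman_domination_number G < roman_domination_number ?H"
  proof (rule roman_domination_number_less_if_block[where S = ?S and h = ?h, OF pair_graph])
    fix f assume f: "roman_dominating ?H f"
    have "1 \<le> f x"
      using A by (intro roman_dominating_isolated[OF f _ x]) simp
    moreover have "2 \<le> f y + f z"
      using A by (intro roman_dominating_isolated_edge[OF f _ _ y z]) simp_all
    ultimately show "sum ?h ?S < sum f ?S"
      using A by simp
  next
    fix u assume "u \<in> ?S" "?h u = 0"
    then have "u = x \<or> u = z" by (auto split: if_splits)
    then show "\<exists>w\<in>?S. (u, w) \<in> parcs G \<and> ?h w = 2"
      using A by auto
  next
    fix u w assume "u \<in> ?S" "(u, w) \<in> parcs ?H"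
    then show "w \<in> ?S" using x y z by blast
  qed (use A in auto)
  show "?B \<subseteq> edges G"
    using A zt by (auto simp: edges_def)
  \<comment> \<open>The maximum degree is at least two because of the neighbours \<open>x\<close> and \<open>z\<close> of \<open>y\<close>.\<close>
  have "card ?B \<le> card {x, z}"
    using A by (auto simp: card_insert_if)
  also have "{x, z} = {u. (y, u) \<in> parcs G}"
    using leg_at_cases[OF leg] A by blast
  also have "card \<dots> \<le> max_degree G"
    using pair_graph A by (intro card_neighbours_le_max_degree)
  finally show "card ?B \<le> max_degree G" .
qed

section \<open>The end of a longest path in a tree\<close>

lemma vpath_Cons_Cons:
  "vpath (x # y # p) G \<longleftrightarrow> (x, y) \<in> parcs G \<and> x \<notin> set (y # p) \<and> vpath (y # p) G"
  by (auto simp: vpath_def vwalk_def dest: in_arcsD1)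

lemma vpath_rev: "vpath p G \<Longrightarrow> vpath (rev p) G"
  by (auto simp: vpath_def vwalk_def set_vwalk_arcs_rev dest: arcs_symmetric)

text \<open>
  Cycles are given by lists of arcs, whereas paths are easier to extend and to compare as lists of
  vertices; this is the passage from the latter to the former.
\<close>

lemma awalk_vwalk_arcs:
  "vwalk p G \<Longrightarrow> awalk (hd p) (vwalk_arcs p) (last p) \<and> pawalk_verts (hd p) (vwalk_arcs p) = p"
proof (induction p rule: vwalk_arcs.induct)
  case (3 x y p)
  then have "vwalk (y # p) G" "(x, y) \<in> parcs G"
    by (auto elim: vwalk_consE)
  with 3 show ?case by (auto simp: awalk_Cons_iff)
qed (auto simp: vwalk_def awalk_Nil_iff)

lemma cycle_of_closed_vpath:
  assumes p: "vpath p G" "3 \<le> length p" and e: "(last p, hd p) \<in> parcs G"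
  shows "\<exists>c. cycle c \<and> 3 \<le> length c"
proof (intro exI conjI)
  let ?q = "p @ [hd p]"
  have ne: "p \<noteq> []" using p by auto
  have "vwalk ?q G"
    using p e ne by (auto simp: vpath_def vwalk_def set_vwalk_arcs_snoc)
  from awalk_vwalk_arcs[OF this] have w: "awalk (hd p) (vwalk_arcs ?q) (hd p)"
    "pawalk_verts (hd p) (vwalk_arcs ?q) = ?q"
    using ne by auto
  have len: "length (vwalk_arcs ?q) = length p"
    by (metis vwalk_length_def vwalk_length_simp length_append_singleton diff_Suc_1)
  have "distinct (tl ?q)"
    using p ne by (cases p) (auto simp: vpath_def)
  then show "cycle (vwalk_arcs ?q)"
    unfolding cycle_def using w len ne by (intro exI[of _ "hd p"]) auto
  show "3 \<le> length (vwalk_arcs ?q)" using len p by simp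
qed

end

text \<open>
  The defining properties of an undirected tree as a locale, so that the facts on walks in the
  underlying symmetric digraph apply directly.
\<close>

locale undirected_tree_graph = pair_graph T for T :: "'a pair_pre_digraph" +
  assumes conn: "connected T"
    and acyclic: "\<not> (\<exists>p. cycle p \<and> 3 \<le> length p)"
begin

lemma closed_set_eq_pverts:
  assumes "S \<subseteq> pverts T" "S \<noteq> {}" and cl: "\<And>u v. u \<in> S \<Longrightarrow> (u, v) \<in> parcs T \<Longrightarrow> v \<in> S"
  shows "S = pverts T"
proof -
  obtain s where s: "s \<in> S" using assms by blast
  have sc: "strongly_connected T"
    using symmetric_connected_imp_strongly_connected conn pair_sym_arcs by blast
  have "v \<in> S" if "v \<in> pverts T" for v
  proof -
    have "s \<rightarrow>\<^sup>*\<^bsub>T\<^esub> v"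
      using sc s assms(1) that by (auto simp: strongly_connected_def)
    then show ?thesis
      by (induction rule: reachable_induct) (use s cl in auto)
  qed
  then show ?thesis using assms(1) by blast
qed

text \<open>
  A neighbour further along the path would close a cycle of length at least three with the part of
  the path up to it.
\<close>

lemma vpath_no_chord:
  assumes p: "vpath (x # y # p) T" and e: "(x, z) \<in> parcs T" "z \<noteq> y"
  shows "z \<notin> set (x # y # p)"
proof
  assume "z \<in> set (x # y # p)"
  then have "z \<in> set p" using e no_loops' by auto
  then obtain as bs where eq: "p = as @ z # bs" by (meson split_list)
  let ?c = "x # y # as @ [z]"
  have "vwalk ?c T"
    by (rule vwalkI_append_l[where q = bs]) (use p eq in \<open>auto simp: vpath_def\<close>)
  then have "vpath ?c T" using p eq by (auto simp: vpath_def)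
  moreover have "(last ?c, hd ?c) \<in> parcs T" using e arcs_symmetric by simp
  ultimately show False using cycle_of_closed_vpath[of ?c] acyclic by auto
qed

definition longest_vpath :: "'a list \<Rightarrow> bool" where
  "longest_vpath p \<longleftrightarrow> vpath p T \<and> (\<forall>q. vpath q T \<longrightarrow> length q \<le> length p)"

lemma ex_longest_vpath: "\<exists>p. longest_vpath p"
proof -
  have "length p \<le> card (pverts T)" if "vpath p T" for p
    using that card_mono[OF pair_finite_verts, of "set p"]
    by (auto simp: vpath_def vwalk_def distinct_card)
  then have bound: "\<forall>p. vpath p T \<longrightarrow> length p < Suc (card (pverts T))"
    by (simp add: less_Suc_eq_le)
  obtain v where "v \<in> pverts T"
    using conn unfolding connected_conv by auto
  then have "vpath [v] T"
    by (simp add: vpath_self)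
  then show ?thesis
    unfolding longest_vpath_def using bound by (rule Lattices_Big.ex_has_greatest_nat)
qed

lemma longest_vpath_same_length:
  "longest_vpath p \<Longrightarrow> vpath q T \<Longrightarrow> length q = length p \<Longrightarrow> longest_vpath q"
  by (simp add: longest_vpath_def)

text \<open>
  Any further neighbour of \<open>x\<close> lies off the path, so it would prolong the path.
\<close>

lemma longest_vpath_end_leaf:
  assumes p: "longest_vpath (x # y # p)"
  shows "leaf_at T x y"
proof -
  have vp: "vpath (x # y # p) T" using p by (simp add: longest_vpath_def)
  have "u = y" if u: "(x, u) \<in> parcs T" for u
  proof (rule ccontr)
    assume "u \<noteq> y"
    then have "u \<notin> set (x # y # p)" by (rule vpath_no_chord[OF vp u])
    then have "vpath (u # x # y # p) T"
      using vp u arcs_symmetric by (subst vpath_Cons_Cons) auto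
    then show False using p by (force simp: longest_vpath_def)
  qed
  then show ?thesis using vp by (auto simp: leaf_at_def vpath_Cons_Cons)
qed

text \<open>
  Acyclicity keeps \<open>w\<close> off the part of the path from \<open>y\<close> on, so \<open>w\<close> can take the place of \<open>x\<close> as
  the end of a longest path.
\<close>

lemma longest_vpath_second:
  assumes p: "longest_vpath (x # y # z # p)" and w: "(y, w) \<in> parcs T" "w \<noteq> z"
  shows "leaf_at T w y"
proof -
  have vp: "vpath (y # z # p) T"
    using p by (simp add: longest_vpath_def vpath_Cons_Cons)
  then have "w \<notin> set (y # z # p)" by (rule vpath_no_chord[OF _ w])
  then have "vpath (w # y # z # p) T"
    using vp w arcs_symmetric by (subst vpath_Cons_Cons) auto
  then have "longest_vpath (w # y # z # p)"
    using p by (auto intro: longest_vpath_same_length)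
  then show ?thesis by (rule longest_vpath_end_leaf)
qed

text \<open>
  If \<open>w\<close> has a neighbour \<open>u\<close> besides \<open>z\<close>, then \<open>u\<close>, \<open>w\<close> can replace \<open>x\<close>, \<open>y\<close> in a longest path.
  So all neighbours of \<open>w\<close> but \<open>z\<close> are leaves at \<open>w\<close>, and without twins there is only one.
\<close>

lemma longest_vpath_third:
  assumes p: "longest_vpath (x # y # z # t # p)" and w: "(z, w) \<in> parcs T" "w \<noteq> t"
    and no_twins: "\<And>a b v. leaf_at T a v \<Longrightarrow> leaf_at T b v \<Longrightarrow> a = b"
  shows "leaf_at T w z \<or> (\<exists>u. leg_at T u w z)"
proof (cases "\<exists>u. (w, u) \<in> parcs T \<and> u \<noteq> z")
  case True
  then obtain u where u: "(w, u) \<in> parcs T" "u \<noteq> z" by blast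
  have vp: "vpath (z # t # p) T"
    using p by (simp add: longest_vpath_def vpath_Cons_Cons)
  then have "w \<notin> set (z # t # p)" by (rule vpath_no_chord[OF _ w])
  then have vw: "vpath (w # z # t # p) T"
    using vp w arcs_symmetric by (subst vpath_Cons_Cons) auto
  then have "u \<notin> set (w # z # t # p)" by (rule vpath_no_chord[OF _ u])
  then have "vpath (u # w # z # t # p) T"
    using vw u arcs_symmetric by (subst vpath_Cons_Cons) auto
  then have "longest_vpath (u # w # z # t # p)"
    using p by (auto intro: longest_vpath_same_length)
  then have "leaf_at T s w" if "(w, s) \<in> parcs T" "s \<noteq> z" for s
    using that by (rule longest_vpath_second)
  then have "leg_at T u w z"
    using u w no_twins arcs_symmetric unfolding leg_at_def by metis
  then show ?thesis by blast
next
  case False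
  then show ?thesis using w arcs_symmetric by (auto simp: leaf_at_def)
qed

text \<open>
  Both ends of a longest path with at least one edge are leaves.  On at most two vertices the path
  is therefore closed under adjacency and exhausts the connected graph, which is too small; on three
  vertices its ends are twin leaves.
\<close>

lemma longest_vpath_length:
  assumes p: "longest_vpath p" and card: "3 \<le> card (pverts T)"
    and no_twins: "\<And>a b v. leaf_at T a v \<Longrightarrow> leaf_at T b v \<Longrightarrow> a = b"
  obtains x y z t q where "p = x # y # z # t # q"
proof -
  have vp: "vpath p T" using p by (simp add: longest_vpath_def)
  have rp: "longest_vpath (rev p)"
    using p vpath_rev[OF vp] by (auto intro: longest_vpath_same_length)
  have small: False if "\<And>u v. u \<in> set p \<Longrightarrow> (u, v) \<in> parcs T \<Longrightarrow> v \<in> set p" "length p < 3"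
  proof -
    have "set p = pverts T"
      using vp that by (intro closed_set_eq_pverts) (auto simp: vpath_def vwalk_def)
    then show False using card_length[of p] card that by simp
  qed
  consider "p = []" | x where "p = [x]" | x y where "p = [x, y]" | x y z where "p = [x, y, z]"
    | x y z t q where "p = x # y # z # t # q"
    by (metis list.exhaust)
  then show thesis
  proof cases
    case 1
    then show ?thesis using vp by (simp add: vpath_def vwalk_def)
  next
    case (2 x)
    have False if "(x, u) \<in> parcs T" for u
    proof -
      have "vpath [x, u] T"
        using that no_loops' in_arcsD2 by (auto simp: vpath_Cons_Cons intro: vpath_self)
      then show False using p 2 by (force simp: longest_vpath_def)
    qed
    then show ?thesis using small 2 by auto
  next
    case (3 x y)
    then have "leaf_at T x y" "leaf_at T y x"
      using p rp longest_vpath_end_leaf by auto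
    then show ?thesis using small 3 by (auto simp: leaf_at_def)
  next
    case (4 x y z)
    then have "leaf_at T x y" "leaf_at T z y"
      using p rp longest_vpath_end_leaf by auto
    then have "x = z" by (rule no_twins)
    then show ?thesis using vp 4 by (simp add: vpath_def)
  next
    case 5
    then show ?thesis by (rule that)
  qed
qed

lemma bondage_le_max_degree:
  assumes card: "3 \<le> card (pverts T)"
  shows "roman_bondage_number T \<le> enat (max_degree T)"
proof (cases "\<exists>a b v. leaf_at T a v \<and> leaf_at T b v \<and> a \<noteq> b")
  case True
  then show ?thesis using bondage_twin_leaves by blast
next
  case False
  then have no_twins: "a = b" if "leaf_at T a v" "leaf_at T b v" for a b v
    using that by blast
  obtain p where p: "longest_vpath p" using ex_longest_vpath by blast
  obtain x y z t q where eq: "p = x # y # z # t # q"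
    by (rule longest_vpath_length[OF p card]) (erule (1) no_twins, blast)
  have vp: "(x, y) \<in> parcs T" "(y, z) \<in> parcs T" "(z, t) \<in> parcs T" "distinct [x, y, z, t]"
    using p by (auto simp: eq longest_vpath_def vpath_Cons_Cons)
  have x: "leaf_at T x y" using p unfolding eq by (rule longest_vpath_end_leaf)
  have "leaf_at T u y" if "(y, u) \<in> parcs T" "u \<noteq> z" for u
    using p that unfolding eq by (rule longest_vpath_second)
  then have leg: "leg_at T x y z"
    using x vp no_twins unfolding leg_at_def by auto
  show ?thesis
  proof (cases "\<exists>w. (z, w) \<in> parcs T \<and> w \<noteq> y \<and> w \<noteq> t")
    case True
    then obtain w where w: "(z, w) \<in> parcs T" "w \<noteq> y" "w \<noteq> t" by blast
    have "leaf_at T w z \<or> (\<exists>u. leg_at T u w z)"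
      using p w no_twins unfolding eq by (intro longest_vpath_third)
    then show ?thesis
      using bondage_leg_leaf[OF leg] bondage_two_legs[OF leg] w by blast
  next
    case False
    then show ?thesis using vp by (intro bondage_pendant_path[OF leg, of t]) auto
  qed
qed

end

theorem corollary5p3:
  fixes T :: "'a pair_pre_digraph"
  assumes "undirected_tree T"
    and "card (pverts T) \<ge> 3"
  shows "roman_bondage_number T \<le> enat (max_degree T)"
proof -
  interpret pair_graph T
    using assms(1) by (simp add: undirected_tree_def)
  interpret undirected_tree_graph T
    using assms(1) by unfold_locales (auto simp: undirected_tree_def)
  show ?thesis using assms(2) by (rule bondage_le_max_degree)
qed

end
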